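(* Every circular 3G matching market of size $N=4$ (four women, four men and four dogs) has a stable matching.
   Context: A circular 3G matching market of size $N$ consists of three disjoint sets of agents (three "genders"), each of size $N$: women $a_1,\dots,a_N$, men $b_1,\dots,b_N$, and dogs $c_1,\dots,c_N$. Every woman has a strict linear preference order on the set of all $N$ men, every man has a strict linear preference order on the set of all $N$ dogs, and every dog has a strict linear preference order on the set of all $N$ women. These orders are arbitrary. A triple consists of one woman, one man and one dog. Agents compare triples containing themselves by the circular rule: a woman strictly prefers one triple to another if and only if she strictly prefers the man in the first to the man in the second; likewise, men compare triples only by the dog in them, and dogs only by the woman in them. A matching is a partition of all the agents into $N$ triples, each consisting of one woman, one man and one dog. A triple $T$ is a blocking triple for a matching if each of the three members of $T$ strictly prefers $T$ to the triple containing that member in the matching. A matching is stable if it has no blocking triple. *)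

theory Defs
  imports Main "HOL-Library.Disjoint_Sets"
begin

text \<open>
  Women, men and dogs live in three types, which may coincide; the constructors below keep
  the three genders disjoint in any case.
\<close>

datatype ('w, 'm, 'd) agent = Woman 'w | Man 'm | Dog 'd

type_synonym ('w, 'm, 'd) triple = "'w \<times> 'm \<times> 'd"

text \<open>
  A pair \<open>(x, y)\<close> in a preference relation means that \<open>x\<close> is strictly preferred to \<open>y\<close>.
\<close>

record ('w, 'm, 'd) market =
  women :: "'w set"
  men :: "'m set"
  dogs :: "'d set"
  wpref :: "'w \<Rightarrow> 'm rel"
  mpref :: "'m \<Rightarrow> 'd rel"
  dpref :: "'d \<Rightarrow> 'w rel"

text \<open>
  \<open>strict_linear_order_on A r\<close> does not confine \<open>r\<close> to \<open>A\<close>, hence the first conjunct.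
\<close>

definition strict_pref_on :: "'a set \<Rightarrow> 'a rel \<Rightarrow> bool" where
  "strict_pref_on A r \<longleftrightarrow> r \<subseteq> A \<times> A \<and> strict_linear_order_on A r"

definition circular_market :: "nat \<Rightarrow> ('w, 'm, 'd) market \<Rightarrow> bool" where
  "circular_market N G \<longleftrightarrow>
     finite (women G) \<and> card (women G) = N \<and>
     finite (men G) \<and> card (men G) = N \<and>
     finite (dogs G) \<and> card (dogs G) = N \<and>
     (\<forall>a \<in> women G. strict_pref_on (men G) (wpref G a)) \<and>
     (\<forall>b \<in> men G. strict_pref_on (dogs G) (mpref G b)) \<and>
     (\<forall>c \<in> dogs G. strict_pref_on (women G) (dpref G c))"

definition agents :: "('w, 'm, 'd) market \<Rightarrow> ('w, 'm, 'd) agent set" where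
  "agents G = Woman ` women G \<union> Man ` men G \<union> Dog ` dogs G"

definition triples :: "('w, 'm, 'd) market \<Rightarrow> ('w, 'm, 'd) triple set" where
  "triples G = women G \<times> men G \<times> dogs G"

fun members :: "('w, 'm, 'd) triple \<Rightarrow> ('w, 'm, 'd) agent set" where
  "members (a, b, c) = {Woman a, Man b, Dog c}"

text \<open>
  \<open>prefers G x S T\<close> is meant for triples \<open>S\<close> and \<open>T\<close> that both contain the agent \<open>x\<close>.
\<close>

fun prefers ::
  "('w, 'm, 'd) market \<Rightarrow> ('w, 'm, 'd) agent \<Rightarrow> ('w, 'm, 'd) triple \<Rightarrow> ('w, 'm, 'd) triple \<Rightarrow> bool"
where
  "prefers G (Woman a) (_, b, _) (_, b', _) \<longleftrightarrow> (b, b') \<in> wpref G a"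
| "prefers G (Man b) (_, _, c) (_, _, c') \<longleftrightarrow> (c, c') \<in> mpref G b"
| "prefers G (Dog c) (a, _, _) (a', _, _) \<longleftrightarrow> (a, a') \<in> dpref G c"

text \<open>
  Since \<open>members\<close> is injective, a set of triples amounts to a set of blocks of agents. When the
  blocks partition the agents of a market of size \<open>N\<close>, there are exactly \<open>N\<close> of them, because
  each block contains exactly one woman.
\<close>

definition matching :: "('w, 'm, 'd) market \<Rightarrow> ('w, 'm, 'd) triple set \<Rightarrow> bool" where
  "matching G M \<longleftrightarrow> M \<subseteq> triples G \<and> partition_on (agents G) (members ` M)"

text \<open>
  In a matching, the triple \<open>S\<close> below exists and is unique for every member \<open>x\<close> of \<open>T\<close>.
\<close>

definition blocking ::
  "('w, 'm, 'd) market \<Rightarrow> ('w, 'm, 'd) triple set \<Rightarrow> ('w, 'm, 'd) triple \<Rightarrow> bool"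
where
  "blocking G M T \<longleftrightarrow>
     T \<in> triples G \<and> (\<forall>x \<in> members T. \<exists>S \<in> M. x \<in> members S \<and> prefers G x T S)"

definition stable_matching :: "('w, 'm, 'd) market \<Rightarrow> ('w, 'm, 'd) triple set \<Rightarrow> bool" where
  "stable_matching G M \<longleftrightarrow> matching G M \<and> (\<nexists>T. blocking G M T)"

end

theory Submission
  imports Defs
begin

text \<open>
  Let every agent point to its favourite and follow three arrows at a time: this maps the women
  to themselves, and the map has a cycle. A fixed point is a triple of mutual favourites, which
  can be removed, by induction on the size of the market. If the cycle misses at most one woman,
  match the women and men on it with their favourites: only one woman and one man remain
  unsatisfied, and they are matched to each other, so nothing blocks. In a market of size 4 this
  leaves a cycle \<open>a\<^sub>0 \<rightarrow> b\<^sub>0 \<rightarrow> c\<^sub>0 \<rightarrow> a\<^sub>1 \<rightarrow> b\<^sub>1 \<rightarrow> c\<^sub>1 \<rightarrow> a\<^sub>0\<close>. There the two men off the cycle must agree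
  on the two dogs off the cycle, and these dogs on the two women off the cycle, since otherwise
  satisfying them yields a stable matching. After relabelling, seven explicit matchings
  cannot all be blocked.
\<close>

section \<open>Matchings and preferences over plain sets\<close>

text \<open>Bijective projections stand in for the partition of the agents into blocks, so that
  matchings can be united by the lemmas on \<open>bij_betw\<close>.\<close>

definition perfect :: "'a set \<Rightarrow> 'b set \<Rightarrow> 'c set \<Rightarrow> ('a \<times> 'b \<times> 'c) set \<Rightarrow> bool" where
  "perfect A B C M \<longleftrightarrow>
     bij_betw fst M A \<and> bij_betw (fst \<circ> snd) M B \<and> bij_betw (snd \<circ> snd) M C"

text \<open>
  For a perfect \<open>M\<close> the three triples below are those that contain the woman, the man and the dog
  of the candidate blocking triple \<open>(a\<^sub>1, b\<^sub>2, c\<^sub>3)\<close>.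
\<close>

definition unblocked ::
  "('a \<Rightarrow> 'b rel) \<Rightarrow> ('b \<Rightarrow> 'c rel) \<Rightarrow> ('c \<Rightarrow> 'a rel) \<Rightarrow> ('a \<times> 'b \<times> 'c) set \<Rightarrow> bool"
where
  "unblocked P Q R M \<longleftrightarrow>
     (\<nexists>a\<^sub>1 b\<^sub>1 c\<^sub>1 a\<^sub>2 b\<^sub>2 c\<^sub>2 a\<^sub>3 b\<^sub>3 c\<^sub>3.
        (a\<^sub>1, b\<^sub>1, c\<^sub>1) \<in> M \<and> (a\<^sub>2, b\<^sub>2, c\<^sub>2) \<in> M \<and> (a\<^sub>3, b\<^sub>3, c\<^sub>3) \<in> M \<and>
        (b\<^sub>2, b\<^sub>1) \<in> P a\<^sub>1 \<and> (c\<^sub>3, c\<^sub>2) \<in> Q b\<^sub>2 \<and> (a\<^sub>1, a\<^sub>3) \<in> R c\<^sub>3)"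

definition solvable ::
  "('a \<Rightarrow> 'b rel) \<Rightarrow> ('b \<Rightarrow> 'c rel) \<Rightarrow> ('c \<Rightarrow> 'a rel) \<Rightarrow> 'a set \<Rightarrow> 'b set \<Rightarrow> 'c set \<Rightarrow> bool"
where
  "solvable P Q R A B C \<longleftrightarrow> (\<exists>M. perfect A B C M \<and> unblocked P Q R M)"

text \<open>The relations are not confined to \<open>B\<close>, so the same \<open>P\<close> serves
  every submarket met in the induction.\<close>

definition linear_prefs :: "'a set \<Rightarrow> 'b set \<Rightarrow> ('a \<Rightarrow> 'b rel) \<Rightarrow> bool" where
  "linear_prefs A B P \<longleftrightarrow> (\<forall>a \<in> A. strict_linear_order_on B (P a))"

definition best :: "'b rel \<Rightarrow> 'b set \<Rightarrow> 'b \<Rightarrow> bool" where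
  "best r B b \<longleftrightarrow> b \<in> B \<and> (\<forall>b' \<in> B. (b', b) \<notin> r)"

lemma unblockedD:
  assumes "unblocked P Q R M" "(a\<^sub>1, b\<^sub>1, c\<^sub>1) \<in> M" "(a\<^sub>2, b\<^sub>2, c\<^sub>2) \<in> M" "(a\<^sub>3, b\<^sub>3, c\<^sub>3) \<in> M"
    and "(b\<^sub>2, b\<^sub>1) \<in> P a\<^sub>1" "(c\<^sub>3, c\<^sub>2) \<in> Q b\<^sub>2" "(a\<^sub>1, a\<^sub>3) \<in> R c\<^sub>3"
  shows False
  using assms unfolding unblocked_def by blast

lemma unblockedI:
  assumes "\<And>a\<^sub>1 b\<^sub>1 c\<^sub>1 a\<^sub>2 b\<^sub>2 c\<^sub>2 a\<^sub>3 b\<^sub>3 c\<^sub>3.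
    (a\<^sub>1, b\<^sub>1, c\<^sub>1) \<in> M \<Longrightarrow> (a\<^sub>2, b\<^sub>2, c\<^sub>2) \<in> M \<Longrightarrow> (a\<^sub>3, b\<^sub>3, c\<^sub>3) \<in> M \<Longrightarrow>
    (b\<^sub>2, b\<^sub>1) \<in> P a\<^sub>1 \<Longrightarrow> (c\<^sub>3, c\<^sub>2) \<in> Q b\<^sub>2 \<Longrightarrow> (a\<^sub>1, a\<^sub>3) \<in> R c\<^sub>3 \<Longrightarrow> False"
  shows "unblocked P Q R M"
  using assms unfolding unblocked_def by blast

lemma perfect_mem:
  assumes "perfect A B C M" "(a, b, c) \<in> M"
  shows "a \<in> A" "b \<in> B" "c \<in> C"
  using assms bij_betwE unfolding perfect_def by fastforce+

lemma perfect_obtain: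
  assumes "perfect A B C M"
  shows "a \<in> A \<Longrightarrow> \<exists>b c. (a, b, c) \<in> M"
    and "b \<in> B \<Longrightarrow> \<exists>a c. (a, b, c) \<in> M"
    and "c \<in> C \<Longrightarrow> \<exists>a b. (a, b, c) \<in> M"
proof -
  have "A = fst ` M" "B = (fst \<circ> snd) ` M" "C = (snd \<circ> snd) ` M"
    using assms by (simp_all add: perfect_def bij_betw_def)
  then show "a \<in> A \<Longrightarrow> \<exists>b c. (a, b, c) \<in> M"
    and "b \<in> B \<Longrightarrow> \<exists>a c. (a, b, c) \<in> M"
    and "c \<in> C \<Longrightarrow> \<exists>a b. (a, b, c) \<in> M"
    by (auto, blast+)
qed

lemma perfect_unique:
  assumes "perfect A B C M" "(a, b, c) \<in> M" "(a', b', c') \<in> M"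
    and "a = a' \<or> b = b' \<or> c = c'"
  shows "(a, b, c) = (a', b', c')"
proof -
  have inj: "inj_on fst M" "inj_on (fst \<circ> snd) M" "inj_on (snd \<circ> snd) M"
    using assms(1) by (simp_all add: perfect_def bij_betw_def)
  show ?thesis
    using assms(4) inj_onD[OF inj(1) _ assms(2,3)] inj_onD[OF inj(2) _ assms(2,3)]
      inj_onD[OF inj(3) _ assms(2,3)] by (elim disjE) simp_all
qed

lemma perfect_graph:
  assumes f: "bij_betw f A B" and g: "bij_betw g B C"
  shows "perfect A B C ((\<lambda>a. (a, f a, g (f a))) ` A)"
proof -
  have h: "bij_betw (g \<circ> f) A C"
    using f g by (rule bij_betw_trans)
  have "bij_betw (\<lambda>a. (a, f a, g (f a))) A ((\<lambda>a. (a, f a, g (f a))) ` A)"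
    by (simp add: bij_betw_def inj_on_def)
  note this[THEN bij_betw_comp_iff]
  from this[of fst] this[of "fst \<circ> snd"] this[of "snd \<circ> snd"] f h bij_betw_id[of A] show ?thesis
    by (simp add: perfect_def comp_def id_def)
qed

lemma perfect_Un:
  assumes "perfect A B C M" "perfect A' B' C' M'"
    and "A \<inter> A' = {}" "B \<inter> B' = {}" "C \<inter> C' = {}"
  shows "perfect (A \<union> A') (B \<union> B') (C \<union> C') (M \<union> M')"
  using assms unfolding perfect_def by (blast intro: bij_betw_combine)

lemma perfect_insert:
  assumes "perfect A B C M" "a \<notin> A" "b \<notin> B" "c \<notin> C"
  shows "perfect (insert a A) (insert b B) (insert c C) (insert (a, b, c) M)"
proof -
  have "perfect {a} {b} {c} {(a, b, c)}"
    by (simp add: perfect_def)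
  from perfect_Un[OF this assms(1)] assms show ?thesis
    by simp
qed

lemma solvableI: "perfect A B C M \<Longrightarrow> unblocked P Q R M \<Longrightarrow> solvable P Q R A B C"
  unfolding solvable_def by blast

lemma linear_prefsD:
  assumes "linear_prefs A B P" "a \<in> A"
  shows linear_prefs_trans: "(x, y) \<in> P a \<Longrightarrow> (y, z) \<in> P a \<Longrightarrow> (x, z) \<in> P a"
    and linear_prefs_irrefl: "(x, x) \<notin> P a"
    and linear_prefs_asym: "(x, y) \<in> P a \<Longrightarrow> (y, x) \<notin> P a"
    and linear_prefs_total: "x \<in> B \<Longrightarrow> y \<in> B \<Longrightarrow> x \<noteq> y \<Longrightarrow> (x, y) \<in> P a \<or> (y, x) \<in> P a"
  using assms unfolding linear_prefs_def strict_linear_order_on_def total_on_def irrefl_def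
  by (blast dest: transD)+

lemma linear_prefs_subset:
  assumes "linear_prefs A B P" "A' \<subseteq> A" "B' \<subseteq> B"
  shows "linear_prefs A' B' P"
  using assms unfolding linear_prefs_def strict_linear_order_on_def total_on_def by blast

lemma best_exists:
  assumes "linear_prefs A B P" "a \<in> A" "finite B" "B \<noteq> {}"
  shows "\<exists>b. best (P a) B b"
proof -
  \<comment> \<open>\<open>P a\<close> may relate elements outside the finite set \<open>B\<close>;
    only its restriction is sure to be well-founded.\<close>
  have "trans (Restr (P a) B)" "irrefl (Restr (P a) B)"
    using assms(1,2)
    by (auto simp: linear_prefs_def strict_linear_order_on_def irrefl_def intro: trans_Restr)
  then have "acyclic (Restr (P a) B)"
    by (simp add: acyclic_irrefl)
  then have "wf (Restr (P a) B)"
    using assms(3) by (simp add: finite_acyclic_wf)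
  moreover from \<open>B \<noteq> {}\<close> obtain x where "x \<in> B"
    by blast
  ultimately obtain b where "b \<in> B" "\<And>b'. (b', b) \<in> Restr (P a) B \<Longrightarrow> b' \<notin> B"
    using wfE_min by metis
  then show ?thesis
    unfolding best_def by blast
qed

section \<open>Removing mutual favourites, and long chains of favourites\<close>

text \<open>Each member of the new triple holds its favourite, so a blocking triple avoids all three
  and would already block the smaller matching.\<close>

lemma solvable_insert:
  assumes "solvable P Q R A B C"
    and "a \<notin> A" "b \<notin> B" "c \<notin> C"
    and "best (P a) (insert b B) b" "best (Q b) (insert c C) c" "best (R c) (insert a A) a"
  shows "solvable P Q R (insert a A) (insert b B) (insert c C)"
proof -
  from assms(1) obtain M where M: "perfect A B C M" "unblocked P Q R M"
    unfolding solvable_def by blast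
  note mem = perfect_mem[OF M(1)]
  have "unblocked P Q R (insert (a, b, c) M)"
  proof (rule unblockedI)
    fix a\<^sub>1 b\<^sub>1 c\<^sub>1 a\<^sub>2 b\<^sub>2 c\<^sub>2 a\<^sub>3 b\<^sub>3 c\<^sub>3
    assume t: "(a\<^sub>1, b\<^sub>1, c\<^sub>1) \<in> insert (a, b, c) M" "(a\<^sub>2, b\<^sub>2, c\<^sub>2) \<in> insert (a, b, c) M"
        "(a\<^sub>3, b\<^sub>3, c\<^sub>3) \<in> insert (a, b, c) M"
      and r: "(b\<^sub>2, b\<^sub>1) \<in> P a\<^sub>1" "(c\<^sub>3, c\<^sub>2) \<in> Q b\<^sub>2" "(a\<^sub>1, a\<^sub>3) \<in> R c\<^sub>3"
    have "(a\<^sub>1, b\<^sub>1, c\<^sub>1) \<noteq> (a, b, c)" "(a\<^sub>2, b\<^sub>2, c\<^sub>2) \<noteq> (a, b, c)" "(a\<^sub>3, b\<^sub>3, c\<^sub>3) \<noteq> (a, b, c)"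
      using t r assms(5-7) mem unfolding best_def by blast+
    with t r show False
      using unblockedD[OF M(2)] by blast
  qed
  with perfect_insert[OF M(1) assms(2-4)] show ?thesis
    unfolding solvable_def by blast
qed

text \<open>The women of \<open>X\<close> and their men hold their favourites, so the woman and the
  man of a blocking triple come from the remainder. This has at most one couple, and there she
  already has him.\<close>

lemma solvable_chain:
  assumes fin: "finite A" "card B = card A" "card C = card A" "finite B" "finite C"
    and P: "linear_prefs A B P"
    and X: "X \<subseteq> A" "card A \<le> Suc (card X)"
    and p: "inj_on p X" "\<And>a. a \<in> X \<Longrightarrow> best (P a) B (p a)"
    and q: "inj_on q (p ` X)" "\<And>b. b \<in> p ` X \<Longrightarrow> best (Q b) C (q b)"
  shows "solvable P Q R A B C"
proof -
  define Y where "Y = p ` X"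
  define Z where "Z = q ` Y"
  have Y: "Y \<subseteq> B" "card Y = card X" and Z: "Z \<subseteq> C" "card Z = card X"
    using p q by (auto simp: Y_def Z_def best_def card_image)
  have fX: "finite X" "finite Y" "finite Z"
    using fin X Y Z finite_subset by blast+
  have c: "card (A - X) = card (B - Y)" "card (B - Y) = card (C - Z)"
    using fin X Y Z fX by (simp_all add: card_Diff_subset)
  \<comment> \<open>The leftover sets have equal sizes, so arbitrary bijections complete the
    matching.\<close>
  obtain f where f: "bij_betw f (A - X) (B - Y)"
    using c(1) fin by (metis finite_Diff finite_same_card_bij)
  obtain g where g: "bij_betw g (B - Y) (C - Z)"
    using c(2) fin by (metis finite_Diff finite_same_card_bij)
  let ?M1 = "(\<lambda>a. (a, p a, q (p a))) ` X" and ?M2 = "(\<lambda>a. (a, f a, g (f a))) ` (A - X)"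
  have M1: "perfect X Y Z ?M1"
    using p(1) q(1) by (intro perfect_graph) (simp_all add: bij_betw_def Y_def Z_def)
  have M2: "perfect (A - X) (B - Y) (C - Z) ?M2"
    using f g by (rule perfect_graph)
  have M: "perfect A B C (?M1 \<union> ?M2)"
    using perfect_Un[OF M1 M2] X(1) Y(1) Z(1) by (simp add: Un_absorb1)
  have "card (A - X) \<le> Suc 0"
    using X fin fX by (simp add: card_Diff_subset)
  then have one: "a = a'" if "a \<in> A - X" "a' \<in> A - X" for a a'
    using that fin(1) by (metis card_le_Suc0_iff_eq finite_Diff)
  have "unblocked P Q R (?M1 \<union> ?M2)"
  proof (rule unblockedI)
    fix a\<^sub>1 b\<^sub>1 c\<^sub>1 a\<^sub>2 b\<^sub>2 c\<^sub>2 a\<^sub>3 b\<^sub>3 c\<^sub>3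
    assume t: "(a\<^sub>1, b\<^sub>1, c\<^sub>1) \<in> ?M1 \<union> ?M2" "(a\<^sub>2, b\<^sub>2, c\<^sub>2) \<in> ?M1 \<union> ?M2" "(a\<^sub>3, b\<^sub>3, c\<^sub>3) \<in> ?M1 \<union> ?M2"
      and r: "(b\<^sub>2, b\<^sub>1) \<in> P a\<^sub>1" "(c\<^sub>3, c\<^sub>2) \<in> Q b\<^sub>2"
    note mem = perfect_mem(2)[OF M t(2)] perfect_mem(3)[OF M t(3)]
    \<comment> \<open>A woman or man with a better option belongs to \<open>?M2\<close>, which has
      at most one triple; so \<open>a\<^sub>1\<close> would prefer her own man to himself.\<close>
    have "a\<^sub>1 \<in> A - X \<and> b\<^sub>1 = f a\<^sub>1"
      using t(1) r(1) mem(1) p(2) unfolding best_def by auto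
    moreover have "a\<^sub>2 \<in> A - X \<and> b\<^sub>2 = f a\<^sub>2"
      using t(2) r(2) mem(2) q(2) unfolding best_def by auto
    ultimately have "a\<^sub>1 \<in> A" "b\<^sub>1 = b\<^sub>2"
      using one[of a\<^sub>1 a\<^sub>2] by auto
    with r(1) show False
      using linear_prefs_irrefl[OF P] by blast
  qed
  with M show ?thesis
    by (rule solvableI)
qed

text \<open>Over an explicit \<open>M\<close> the bounded quantifiers unfold, and simplification
  leaves a finite disjunction of comparisons.\<close>

lemma not_unblocked_iff:
  "\<not> unblocked P Q R M \<longleftrightarrow>
     (\<exists>(a\<^sub>1, b\<^sub>1, c\<^sub>1) \<in> M. \<exists>(a\<^sub>2, b\<^sub>2, c\<^sub>2) \<in> M. \<exists>(a\<^sub>3, b\<^sub>3, c\<^sub>3) \<in> M.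
        (b\<^sub>2, b\<^sub>1) \<in> P a\<^sub>1 \<and> (c\<^sub>3, c\<^sub>2) \<in> Q b\<^sub>2 \<and> (a\<^sub>1, a\<^sub>3) \<in> R c\<^sub>3)"
  unfolding unblocked_def Bex_def by (simp add: split_paired_Ex) blast

lemma perfect_four:
  assumes "distinct [a\<^sub>0, a\<^sub>1, a\<^sub>2, a\<^sub>3]" "distinct [b\<^sub>0, b\<^sub>1, b\<^sub>2, b\<^sub>3]" "distinct [c\<^sub>0, c\<^sub>1, c\<^sub>2, c\<^sub>3]"
  shows "perfect {a\<^sub>0, a\<^sub>1, a\<^sub>2, a\<^sub>3} {b\<^sub>0, b\<^sub>1, b\<^sub>2, b\<^sub>3} {c\<^sub>0, c\<^sub>1, c\<^sub>2, c\<^sub>3}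
    {(a\<^sub>0, b\<^sub>0, c\<^sub>0), (a\<^sub>1, b\<^sub>1, c\<^sub>1), (a\<^sub>2, b\<^sub>2, c\<^sub>2), (a\<^sub>3, b\<^sub>3, c\<^sub>3)}"
proof -
  have "perfect {} {} {} {}"
    by (simp add: perfect_def bij_betw_def)
  then show ?thesis
    using assms by (intro perfect_insert) auto
qed

section \<open>Markets of size 4 with a cycle through two women\<close>

text \<open>A supposed counterexample. Indices 0 and 1 lie on the cycle; 2 and 3 can be exchanged
  for each gender separately, so every relabelling is a new instance of the locale.\<close>

locale two_cycle =
  fixes P :: "'a \<Rightarrow> 'b rel" and Q :: "'b \<Rightarrow> 'c rel" and R :: "'c \<Rightarrow> 'a rel"
    and a\<^sub>0 a\<^sub>1 a\<^sub>2 a\<^sub>3 :: 'a and b\<^sub>0 b\<^sub>1 b\<^sub>2 b\<^sub>3 :: 'b and c\<^sub>0 c\<^sub>1 c\<^sub>2 c\<^sub>3 :: 'c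
  assumes distinct: "distinct [a\<^sub>0, a\<^sub>1, a\<^sub>2, a\<^sub>3]" "distinct [b\<^sub>0, b\<^sub>1, b\<^sub>2, b\<^sub>3]"
      "distinct [c\<^sub>0, c\<^sub>1, c\<^sub>2, c\<^sub>3]"
    and linear: "linear_prefs {a\<^sub>0, a\<^sub>1, a\<^sub>2, a\<^sub>3} {b\<^sub>0, b\<^sub>1, b\<^sub>2, b\<^sub>3} P"
      "linear_prefs {b\<^sub>0, b\<^sub>1, b\<^sub>2, b\<^sub>3} {c\<^sub>0, c\<^sub>1, c\<^sub>2, c\<^sub>3} Q"
      "linear_prefs {c\<^sub>0, c\<^sub>1, c\<^sub>2, c\<^sub>3} {a\<^sub>0, a\<^sub>1, a\<^sub>2, a\<^sub>3} R"
    and best: "best (P a\<^sub>0) {b\<^sub>0, b\<^sub>1, b\<^sub>2, b\<^sub>3} b\<^sub>0" "best (Q b\<^sub>0) {c\<^sub>0, c\<^sub>1, c\<^sub>2, c\<^sub>3} c\<^sub>0"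
      "best (R c\<^sub>0) {a\<^sub>0, a\<^sub>1, a\<^sub>2, a\<^sub>3} a\<^sub>1" "best (P a\<^sub>1) {b\<^sub>0, b\<^sub>1, b\<^sub>2, b\<^sub>3} b\<^sub>1"
      "best (Q b\<^sub>1) {c\<^sub>0, c\<^sub>1, c\<^sub>2, c\<^sub>3} c\<^sub>1" "best (R c\<^sub>1) {a\<^sub>0, a\<^sub>1, a\<^sub>2, a\<^sub>3} a\<^sub>0"
    and unsolvable: "\<not> solvable P Q R {a\<^sub>0, a\<^sub>1, a\<^sub>2, a\<^sub>3} {b\<^sub>0, b\<^sub>1, b\<^sub>2, b\<^sub>3} {c\<^sub>0, c\<^sub>1, c\<^sub>2, c\<^sub>3}"
begin

lemma irrefl [simp]:
  "a \<in> {a\<^sub>0, a\<^sub>1, a\<^sub>2, a\<^sub>3} \<Longrightarrow> (b, b) \<notin> P a"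
  "b \<in> {b\<^sub>0, b\<^sub>1, b\<^sub>2, b\<^sub>3} \<Longrightarrow> (c, c) \<notin> Q b"
  "c \<in> {c\<^sub>0, c\<^sub>1, c\<^sub>2, c\<^sub>3} \<Longrightarrow> (a, a) \<notin> R c"
  using linear[THEN linear_prefs_irrefl] by blast+

lemma blocked:
  assumes "distinct [x\<^sub>0, x\<^sub>1, x\<^sub>2, x\<^sub>3]" "{x\<^sub>0, x\<^sub>1, x\<^sub>2, x\<^sub>3} = {b\<^sub>0, b\<^sub>1, b\<^sub>2, b\<^sub>3}"
    and "distinct [y\<^sub>0, y\<^sub>1, y\<^sub>2, y\<^sub>3]" "{y\<^sub>0, y\<^sub>1, y\<^sub>2, y\<^sub>3} = {c\<^sub>0, c\<^sub>1, c\<^sub>2, c\<^sub>3}"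
  shows "\<not> unblocked P Q R {(a\<^sub>0, x\<^sub>0, y\<^sub>0), (a\<^sub>1, x\<^sub>1, y\<^sub>1), (a\<^sub>2, x\<^sub>2, y\<^sub>2), (a\<^sub>3, x\<^sub>3, y\<^sub>3)}"
  using perfect_four[OF distinct(1) assms(1,3)] unsolvable unfolding assms(2,4) solvable_def
  by blast

text \<open>Half a turn of the cycle.\<close>

lemma swapped: "two_cycle P Q R a\<^sub>1 a\<^sub>0 a\<^sub>2 a\<^sub>3 b\<^sub>1 b\<^sub>0 b\<^sub>2 b\<^sub>3 c\<^sub>1 c\<^sub>0 c\<^sub>2 c\<^sub>3"
  using distinct linear best unsolvable by unfold_locales (auto simp: insert_commute)

lemma asym:
  "a \<in> {a\<^sub>0, a\<^sub>1, a\<^sub>2, a\<^sub>3} \<Longrightarrow> (x, y) \<in> P a \<Longrightarrow> (y, x) \<notin> P a"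
  "b \<in> {b\<^sub>0, b\<^sub>1, b\<^sub>2, b\<^sub>3} \<Longrightarrow> (x', y') \<in> Q b \<Longrightarrow> (y', x') \<notin> Q b"
  "c \<in> {c\<^sub>0, c\<^sub>1, c\<^sub>2, c\<^sub>3} \<Longrightarrow> (x'', y'') \<in> R c \<Longrightarrow> (y'', x'') \<notin> R c"
  by (fact linear[THEN linear_prefs_asym])+

text \<open>The men and dogs on the cycle can all hold their favourites at once. A blocking triple
  then needs a man and a dog off the cycle, but each such man already has the better of these two
  dogs.\<close>

lemma men_agree:
  assumes "(c\<^sub>2, c\<^sub>3) \<in> Q b\<^sub>2" "(c\<^sub>3, c\<^sub>2) \<in> Q b\<^sub>3"
  shows False
proof -
  have "(c\<^sub>3, c\<^sub>2) \<notin> Q b\<^sub>2" "(c\<^sub>2, c\<^sub>3) \<notin> Q b\<^sub>3"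
    using assms asym(2)[of b\<^sub>2] asym(2)[of b\<^sub>3] by blast+
  moreover have "\<not> unblocked P Q R {(a\<^sub>0, b\<^sub>1, c\<^sub>1), (a\<^sub>1, b\<^sub>0, c\<^sub>0), (a\<^sub>2, b\<^sub>2, c\<^sub>2), (a\<^sub>3, b\<^sub>3, c\<^sub>3)}"
    using distinct by (intro blocked) auto
  ultimately show False
    using best by (simp add: best_def not_unblocked_iff)
qed

text \<open>The same idea one gender further: the women and dogs on the cycle hold their favourites,
  and each dog off it has the better of the other two women.\<close>

lemma dogs_agree:
  assumes "(a\<^sub>2, a\<^sub>3) \<in> R c\<^sub>2" "(a\<^sub>3, a\<^sub>2) \<in> R c\<^sub>3"
  shows False
proof -
  have "(a\<^sub>3, a\<^sub>2) \<notin> R c\<^sub>2" "(a\<^sub>2, a\<^sub>3) \<notin> R c\<^sub>3"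
    using assms asym(3)[of c\<^sub>2] asym(3)[of c\<^sub>3] by blast+
  moreover have "\<not> unblocked P Q R {(a\<^sub>0, b\<^sub>0, c\<^sub>1), (a\<^sub>1, b\<^sub>1, c\<^sub>0), (a\<^sub>2, b\<^sub>2, c\<^sub>2), (a\<^sub>3, b\<^sub>3, c\<^sub>3)}"
    using distinct by (intro blocked) auto
  ultimately show False
    using best by (simp add: best_def not_unblocked_iff)
qed

text \<open>
  The seven matchings below were found by a computer search. All of them are blocked, and each one
  contributes a comparison; the last two comparisons contradict each other.
\<close>

lemma agreed_contradiction:
  assumes agreed: "(b\<^sub>2, b\<^sub>3) \<in> P a\<^sub>2" "(c\<^sub>2, c\<^sub>3) \<in> Q b\<^sub>2" "(c\<^sub>2, c\<^sub>3) \<in> Q b\<^sub>3"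
      "(a\<^sub>2, a\<^sub>3) \<in> R c\<^sub>2" "(a\<^sub>2, a\<^sub>3) \<in> R c\<^sub>3"
    and c\<^sub>2: "(a\<^sub>0, a\<^sub>1) \<in> R c\<^sub>2"
  shows False
proof -
  note trans = linear_prefs_trans[OF linear(3)]
  have n: "(b\<^sub>3, b\<^sub>2) \<notin> P a\<^sub>2" "(c\<^sub>3, c\<^sub>2) \<notin> Q b\<^sub>2" "(c\<^sub>3, c\<^sub>2) \<notin> Q b\<^sub>3"
      "(a\<^sub>3, a\<^sub>2) \<notin> R c\<^sub>2" "(a\<^sub>3, a\<^sub>2) \<notin> R c\<^sub>3" "(a\<^sub>1, a\<^sub>0) \<notin> R c\<^sub>2"
    using assms asym(1)[of a\<^sub>2] asym(2)[of b\<^sub>2] asym(2)[of b\<^sub>3]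
      asym(3)[of c\<^sub>2] asym(3)[of c\<^sub>3] by blast+
  \<comment> \<open>Only \<open>b\<^sub>2\<close> and \<open>c\<^sub>2\<close> can be the man and
    the dog of a blocking triple here.\<close>
  have "(a\<^sub>0, a\<^sub>2) \<in> R c\<^sub>2 \<or> (a\<^sub>1, a\<^sub>2) \<in> R c\<^sub>2"
  proof -
    have "\<not> unblocked P Q R {(a\<^sub>0, b\<^sub>1, c\<^sub>1), (a\<^sub>1, b\<^sub>0, c\<^sub>0), (a\<^sub>2, b\<^sub>3, c\<^sub>2), (a\<^sub>3, b\<^sub>2, c\<^sub>3)}"
      using distinct by (intro blocked) auto
    with best n show ?thesis
      by (auto simp: best_def not_unblocked_iff)
  qed
  then have "(a\<^sub>0, a\<^sub>2) \<in> R c\<^sub>2"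
    using c\<^sub>2 trans[of c\<^sub>2 a\<^sub>0 a\<^sub>1 a\<^sub>2] by blast
  \<comment> \<open>Now \<open>a\<^sub>0\<close> is the favourite of \<open>c\<^sub>2\<close>. All
    further matchings put them together, so \<open>c\<^sub>2\<close> joins no blocking
    triple.\<close>
  then have n2: "(a\<^sub>2, a\<^sub>0) \<notin> R c\<^sub>2" "(a\<^sub>3, a\<^sub>0) \<notin> R c\<^sub>2"
    using agreed(4) trans[of c\<^sub>2 a\<^sub>0 a\<^sub>2 a\<^sub>3] asym(3)[of c\<^sub>2] by blast+
  have "(a\<^sub>2, a\<^sub>3) \<in> R c\<^sub>1"
  proof -
    have "\<not> unblocked P Q R {(a\<^sub>0, b\<^sub>0, c\<^sub>2), (a\<^sub>1, b\<^sub>1, c\<^sub>0), (a\<^sub>2, b\<^sub>2, c\<^sub>3), (a\<^sub>3, b\<^sub>3, c\<^sub>1)}"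
      using distinct by (intro blocked) auto
    with best n n2 show ?thesis
      by (auto simp: best_def not_unblocked_iff)
  qed
  then have n1: "(a\<^sub>3, a\<^sub>2) \<notin> R c\<^sub>1"
    using asym(3)[of c\<^sub>1] by blast
  \<comment> \<open>Only \<open>c\<^sub>1\<close> can be the blocking dog, with woman
    \<open>a\<^sub>1\<close> or \<open>a\<^sub>0\<close>; the latter compares
    \<open>b\<^sub>2\<close> with \<open>b\<^sub>3\<close>. The next matching exchanges these men
    and flips her comparison, so the common alternative remains.\<close>
  have "(a\<^sub>1, a\<^sub>2) \<in> R c\<^sub>1 \<or> (b\<^sub>2, b\<^sub>3) \<in> P a\<^sub>0"
  proof -
    have "\<not> unblocked P Q R {(a\<^sub>0, b\<^sub>3, c\<^sub>2), (a\<^sub>1, b\<^sub>0, c\<^sub>0), (a\<^sub>2, b\<^sub>1, c\<^sub>1), (a\<^sub>3, b\<^sub>2, c\<^sub>3)}"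
      using distinct by (intro blocked) auto
    with best n n2 n1 show ?thesis
      by (auto simp: best_def not_unblocked_iff)
  qed
  moreover have "(a\<^sub>1, a\<^sub>2) \<in> R c\<^sub>1 \<or> (b\<^sub>3, b\<^sub>2) \<in> P a\<^sub>0"
  proof -
    have "\<not> unblocked P Q R {(a\<^sub>0, b\<^sub>2, c\<^sub>2), (a\<^sub>1, b\<^sub>0, c\<^sub>0), (a\<^sub>2, b\<^sub>1, c\<^sub>1), (a\<^sub>3, b\<^sub>3, c\<^sub>3)}"
      using distinct by (intro blocked) auto
    with best n n2 n1 show ?thesis
      by (auto simp: best_def not_unblocked_iff)
  qed
  ultimately have "(a\<^sub>1, a\<^sub>2) \<in> R c\<^sub>1"
    using asym(1)[of a\<^sub>0] by blast
  \<comment> \<open>From here on \<open>c\<^sub>1\<close> is matched to \<open>a\<^sub>1\<close> and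
    would leave her only for \<open>a\<^sub>0\<close>.\<close>
  then have n1': "(a\<^sub>2, a\<^sub>1) \<notin> R c\<^sub>1" "(a\<^sub>3, a\<^sub>1) \<notin> R c\<^sub>1"
    using \<open>(a\<^sub>2, a\<^sub>3) \<in> R c\<^sub>1\<close> trans[of c\<^sub>1 a\<^sub>1 a\<^sub>2 a\<^sub>3] asym(3)[of c\<^sub>1] by blast+
  have "(a\<^sub>2, a\<^sub>3) \<in> R c\<^sub>0"
  proof -
    have "\<not> unblocked P Q R {(a\<^sub>0, b\<^sub>0, c\<^sub>2), (a\<^sub>1, b\<^sub>1, c\<^sub>1), (a\<^sub>2, b\<^sub>3, c\<^sub>3), (a\<^sub>3, b\<^sub>2, c\<^sub>0)}"
      using distinct by (intro blocked) auto
    with best n n2 n1' show ?thesis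
      by (auto simp: best_def not_unblocked_iff)
  qed
  then have n0: "(a\<^sub>3, a\<^sub>2) \<notin> R c\<^sub>0"
    using asym(3)[of c\<^sub>0] by blast
  \<comment> \<open>In the last two matchings only \<open>a\<^sub>0\<close> can be the blocking
    woman, with whichever of \<open>b\<^sub>2\<close> and \<open>b\<^sub>3\<close> she
    lacks.\<close>
  have "(b\<^sub>2, b\<^sub>3) \<in> P a\<^sub>0"
  proof -
    have "\<not> unblocked P Q R {(a\<^sub>0, b\<^sub>3, c\<^sub>2), (a\<^sub>1, b\<^sub>1, c\<^sub>1), (a\<^sub>2, b\<^sub>2, c\<^sub>3), (a\<^sub>3, b\<^sub>0, c\<^sub>0)}"
      using distinct by (intro blocked) auto
    with best n n2 n1' n0 show ?thesis
      by (auto simp: best_def not_unblocked_iff)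
  qed
  moreover have "(b\<^sub>3, b\<^sub>2) \<in> P a\<^sub>0"
  proof -
    have "\<not> unblocked P Q R {(a\<^sub>0, b\<^sub>2, c\<^sub>2), (a\<^sub>1, b\<^sub>1, c\<^sub>1), (a\<^sub>2, b\<^sub>0, c\<^sub>0), (a\<^sub>3, b\<^sub>3, c\<^sub>3)}"
      using distinct by (intro blocked) auto
    with best n n2 n1' n0 show ?thesis
      by (auto simp: best_def not_unblocked_iff)
  qed
  ultimately show False
    using asym(1)[of a\<^sub>0] by blast
qed

section \<open>Relabelling the agents off the cycle\<close>

lemma swap_a: "two_cycle P Q R a\<^sub>0 a\<^sub>1 a\<^sub>3 a\<^sub>2 b\<^sub>0 b\<^sub>1 b\<^sub>2 b\<^sub>3 c\<^sub>0 c\<^sub>1 c\<^sub>2 c\<^sub>3"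
  using distinct linear best unsolvable by unfold_locales (auto simp: insert_commute)

lemma swap_b: "two_cycle P Q R a\<^sub>0 a\<^sub>1 a\<^sub>2 a\<^sub>3 b\<^sub>0 b\<^sub>1 b\<^sub>3 b\<^sub>2 c\<^sub>0 c\<^sub>1 c\<^sub>2 c\<^sub>3"
  using distinct linear best unsolvable by unfold_locales (auto simp: insert_commute)

lemma swap_c: "two_cycle P Q R a\<^sub>0 a\<^sub>1 a\<^sub>2 a\<^sub>3 b\<^sub>0 b\<^sub>1 b\<^sub>2 b\<^sub>3 c\<^sub>0 c\<^sub>1 c\<^sub>3 c\<^sub>2"
  using distinct linear best unsolvable by unfold_locales (auto simp: insert_commute)

lemma total:
  "(b\<^sub>2, b\<^sub>3) \<in> P a\<^sub>2 \<or> (b\<^sub>3, b\<^sub>2) \<in> P a\<^sub>2"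
  "(c\<^sub>2, c\<^sub>3) \<in> Q b\<^sub>2 \<or> (c\<^sub>3, c\<^sub>2) \<in> Q b\<^sub>2" "(c\<^sub>2, c\<^sub>3) \<in> Q b\<^sub>3 \<or> (c\<^sub>3, c\<^sub>2) \<in> Q b\<^sub>3"
  "(a\<^sub>2, a\<^sub>3) \<in> R c\<^sub>2 \<or> (a\<^sub>3, a\<^sub>2) \<in> R c\<^sub>2" "(a\<^sub>2, a\<^sub>3) \<in> R c\<^sub>3 \<or> (a\<^sub>3, a\<^sub>2) \<in> R c\<^sub>3"
  "(a\<^sub>0, a\<^sub>1) \<in> R c\<^sub>2 \<or> (a\<^sub>1, a\<^sub>0) \<in> R c\<^sub>2"
  using linear[THEN linear_prefs_total] distinct by simp_all

text \<open>The assumptions concern only agents off the cycle, so half a turn keeps them and covers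
  the other ranking of \<open>a\<^sub>0\<close> and \<open>a\<^sub>1\<close> by
  \<open>c\<^sub>2\<close>.\<close>

lemma all_agreed_contradiction:
  assumes "(b\<^sub>2, b\<^sub>3) \<in> P a\<^sub>2" "(c\<^sub>2, c\<^sub>3) \<in> Q b\<^sub>2" "(c\<^sub>2, c\<^sub>3) \<in> Q b\<^sub>3"
    and "(a\<^sub>2, a\<^sub>3) \<in> R c\<^sub>2" "(a\<^sub>2, a\<^sub>3) \<in> R c\<^sub>3"
  shows False
  using total(6) agreed_contradiction[OF assms] two_cycle.agreed_contradiction[OF swapped assms]
  by blast

text \<open>Renaming the men lets \<open>a\<^sub>2\<close> prefer \<open>b\<^sub>2\<close>; it
  exchanges the first two assumptions, hence \<open>assms(2,1,3,4)\<close>.\<close>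

lemma men_dogs_agreed_contradiction:
  assumes "(c\<^sub>2, c\<^sub>3) \<in> Q b\<^sub>2" "(c\<^sub>2, c\<^sub>3) \<in> Q b\<^sub>3" "(a\<^sub>2, a\<^sub>3) \<in> R c\<^sub>2" "(a\<^sub>2, a\<^sub>3) \<in> R c\<^sub>3"
  shows False
  using total(1) all_agreed_contradiction[OF _ assms]
    two_cycle.all_agreed_contradiction[OF swap_b _ assms(2,1,3,4)]
  by blast

text \<open>Disagreeing dogs fall to \<open>dogs_agree\<close>, possibly with the women renamed; for
  agreeing dogs, renaming makes \<open>a\<^sub>2\<close> the woman they prefer.\<close>

lemma men_agreed_contradiction:
  assumes "(c\<^sub>2, c\<^sub>3) \<in> Q b\<^sub>2" "(c\<^sub>2, c\<^sub>3) \<in> Q b\<^sub>3"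
  shows False
  using total(4,5) dogs_agree two_cycle.dogs_agree[OF swap_a]
    men_dogs_agreed_contradiction[OF assms]
    two_cycle.men_dogs_agreed_contradiction[OF swap_a assms]
  by blast

lemma contradiction: False
  using total(2,3) men_agree two_cycle.men_agree[OF swap_c]
    men_agreed_contradiction two_cycle.men_agreed_contradiction[OF swap_c]
  by blast

end

section \<open>Cycles of favourites and the induction on the size\<close>

text \<open>
  A minimal nonempty set closed under \<open>t\<close> is a cycle of \<open>t\<close>.
\<close>

lemma exists_permuted_subset:
  assumes "finite A" "A \<noteq> {}" "t ` A \<subseteq> A"
  obtains X where "X \<subseteq> A" "X \<noteq> {}" "t ` X = X" "inj_on t X"
    "\<And>Y. Y \<subseteq> X \<Longrightarrow> Y \<noteq> {} \<Longrightarrow> t ` Y \<subseteq> Y \<Longrightarrow> Y = X"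
proof -
  let ?closed = "\<lambda>X. X \<subseteq> A \<and> X \<noteq> {} \<and> t ` X \<subseteq> X"
  obtain X where X: "?closed X" and min: "\<And>Y. ?closed Y \<Longrightarrow> card X \<le> card Y"
    using ex_has_least_nat[of ?closed A card] assms by blast
  have fin: "finite X"
    using X assms(1) finite_subset by blast
  have eq: "Y = X" if "Y \<subseteq> X" "Y \<noteq> {}" "t ` Y \<subseteq> Y" for Y
    using that min[of Y] X card_seteq[OF fin] by (meson order_trans)
  \<comment> \<open>The image of a closed set is closed, so minimality applies to it.\<close>
  have "t ` X = X"
    using eq[of "t ` X"] X by blast
  moreover from this have "inj_on t X"
    using fin by (simp add: eq_card_imp_inj_on)
  ultimately show ?thesis
    using that X eq by blast
qed

lemma card_4_completion:
  assumes "card S = 4" "x\<^sub>0 \<in> S" "x\<^sub>1 \<in> S" "x\<^sub>0 \<noteq> x\<^sub>1"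
  obtains x\<^sub>2 x\<^sub>3 where "S = {x\<^sub>0, x\<^sub>1, x\<^sub>2, x\<^sub>3}" "distinct [x\<^sub>0, x\<^sub>1, x\<^sub>2, x\<^sub>3]"
proof -
  have "card (S - {x\<^sub>0, x\<^sub>1}) = 2"
    using assms by (simp add: card_Diff_subset)
  then obtain x\<^sub>2 x\<^sub>3 where "S - {x\<^sub>0, x\<^sub>1} = {x\<^sub>2, x\<^sub>3}" "x\<^sub>2 \<noteq> x\<^sub>3"
    by (auto simp: card_2_iff)
  moreover from this assms have "S = {x\<^sub>0, x\<^sub>1, x\<^sub>2, x\<^sub>3}"
    by blast
  ultimately show ?thesis
    using that assms(4) by auto
qed

text \<open>An upper bound on the size, rather than size 4 itself, lets the induction reach the
  markets left after removing mutual favourites.\<close>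

lemma linear_prefs_solvable:
  assumes "finite A" "finite B" "finite C" "card B = card A" "card C = card A" "card A \<le> 4"
    and "linear_prefs A B P" "linear_prefs B C Q" "linear_prefs C A R"
  shows "solvable P Q R A B C"
  using assms
proof (induction "card A" arbitrary: A B C)
  case 0
  then have "A = {}" "B = {}" "C = {}"
    by simp_all
  then show ?case
    by (intro solvableI[of _ _ _ "{}"]) (simp_all add: perfect_def unblocked_def bij_betw_def)
next
  case (Suc n)
  note fin = Suc.prems(1-3) and card = Suc.prems(4,5) and lin = Suc.prems(7-9)
  have ne: "A \<noteq> {}" "B \<noteq> {}" "C \<noteq> {}"
    using Suc.hyps(2) card by auto
  obtain p where p: "\<And>a. a \<in> A \<Longrightarrow> best (P a) B (p a)"
    using best_exists[OF lin(1) _ fin(2) ne(2)] by metis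
  obtain q where q: "\<And>b. b \<in> B \<Longrightarrow> best (Q b) C (q b)"
    using best_exists[OF lin(2) _ fin(3) ne(3)] by metis
  obtain r where r: "\<And>c. c \<in> C \<Longrightarrow> best (R c) A (r c)"
    using best_exists[OF lin(3) _ fin(1) ne(1)] by metis
  have mem: "p a \<in> B" "q (p a) \<in> C" "r (q (p a)) \<in> A" if "a \<in> A" for a
    using that p q r unfolding best_def by blast+
  define t where "t a = r (q (p a))" for a
  have "t ` A \<subseteq> A"
    using mem by (auto simp: t_def)
  then obtain X where X: "X \<subseteq> A" "X \<noteq> {}" "t ` X = X" "inj_on t X"
    and min: "\<And>Y. Y \<subseteq> X \<Longrightarrow> Y \<noteq> {} \<Longrightarrow> t ` Y \<subseteq> Y \<Longrightarrow> Y = X"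
    using exists_permuted_subset[OF fin(1) ne(1)] by metis
  \<comment> \<open>Injectivity of the composite \<open>t\<close> passes to its inner
    factors.\<close>
  have pX: "inj_on p X" and qX: "inj_on q (p ` X)"
    using X(4) by (auto simp: t_def inj_on_def)
  have "finite X"
    using X(1) fin(1) finite_subset by blast
  with X(2) have "card X \<noteq> 0"
    by simp
  \<comment> \<open>Outside the first two cases, 2 \<le> \<open>card X\<close> \<le>
    \<open>card A - 2\<close> \<le> 2.\<close>
  consider "card X = 1" | "card A \<le> Suc (card X)" | "card X = 2" "card A = 4"
    using \<open>card X \<noteq> 0\<close> Suc.prems(6) by linarith
  then show ?case
  proof cases
    case 1
    then obtain a where "X = {a}"
      by (auto simp: card_1_singleton_iff)
    then have a: "a \<in> A" "r (q (p a)) = a"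
      using X by (auto simp: t_def)
    let ?A = "A - {a}" and ?B = "B - {p a}" and ?C = "C - {q (p a)}"
    have "solvable P Q R ?A ?B ?C"
    proof (rule Suc.hyps(1))
      show "n = card ?A" "card ?B = card ?A" "card ?C = card ?A" "card ?A \<le> 4"
        using Suc.hyps(2) Suc.prems a mem[OF a(1)] by simp_all
      show "linear_prefs ?A ?B P" "linear_prefs ?B ?C Q" "linear_prefs ?C ?A R"
        by (rule lin[THEN linear_prefs_subset, OF Diff_subset Diff_subset])+
    qed (use fin in simp_all)
    then have "solvable P Q R (insert a ?A) (insert (p a) ?B) (insert (q (p a)) ?C)"
      using a mem[OF a(1)] p[of a] q[of "p a"] r[of "q (p a)"]
      by (intro solvable_insert) (simp_all add: insert_absorb)
    then show ?thesis
      using a mem[OF a(1)] by (simp add: insert_absorb)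
  next
    case 2
    show ?thesis
      using fin(1) card fin(2,3) lin(1) X(1) 2 pX _ qX
    proof (rule solvable_chain)
      show "best (P a) B (p a)" if "a \<in> X" for a
        using that X(1) p by blast
      show "best (Q b) C (q b)" if "b \<in> p ` X" for b
        using that X(1) q mem by blast
    qed
  next
    case 3
    obtain a\<^sub>0 a\<^sub>1 where a: "X = {a\<^sub>0, a\<^sub>1}" "a\<^sub>0 \<noteq> a\<^sub>1"
      using 3(1) by (auto simp: card_2_iff)
    \<comment> \<open>A fixed point would be a smaller closed set.\<close>
    have t: "t a\<^sub>0 = a\<^sub>1" "t a\<^sub>1 = a\<^sub>0"
      using X(3) min[of "{a\<^sub>0}"] min[of "{a\<^sub>1}"] a by auto
    define b\<^sub>0 b\<^sub>1 c\<^sub>0 c\<^sub>1 where defs: "b\<^sub>0 = p a\<^sub>0" "b\<^sub>1 = p a\<^sub>1" "c\<^sub>0 = q b\<^sub>0" "c\<^sub>1 = q b\<^sub>1"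
    have A: "a\<^sub>0 \<in> A" "a\<^sub>1 \<in> A"
      using X(1) a by auto
    have B: "b\<^sub>0 \<in> B" "b\<^sub>1 \<in> B" and C: "c\<^sub>0 \<in> C" "c\<^sub>1 \<in> C"
      using A mem by (simp_all add: defs)
    have rc: "r c\<^sub>0 = a\<^sub>1" "r c\<^sub>1 = a\<^sub>0"
      using t by (simp_all add: defs t_def)
    \<comment> \<open>\<open>r\<close> separates the dogs, and therefore \<open>q\<close> separates
      the men.\<close>
    then have "c\<^sub>0 \<noteq> c\<^sub>1"
      using a(2) by auto
    moreover from this have "b\<^sub>0 \<noteq> b\<^sub>1"
      by (auto simp: defs)
    moreover note a(2) A B C 3(2) card
    ultimately obtain a\<^sub>2 a\<^sub>3 b\<^sub>2 b\<^sub>3 c\<^sub>2 c\<^sub>3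
      where eqs: "A = {a\<^sub>0, a\<^sub>1, a\<^sub>2, a\<^sub>3}" "B = {b\<^sub>0, b\<^sub>1, b\<^sub>2, b\<^sub>3}" "C = {c\<^sub>0, c\<^sub>1, c\<^sub>2, c\<^sub>3}"
        and dist: "distinct [a\<^sub>0, a\<^sub>1, a\<^sub>2, a\<^sub>3]" "distinct [b\<^sub>0, b\<^sub>1, b\<^sub>2, b\<^sub>3]"
          "distinct [c\<^sub>0, c\<^sub>1, c\<^sub>2, c\<^sub>3]"
      using card_4_completion by metis
    have best: "best (P a\<^sub>0) B b\<^sub>0" "best (Q b\<^sub>0) C c\<^sub>0" "best (R c\<^sub>0) A a\<^sub>1"
      "best (P a\<^sub>1) B b\<^sub>1" "best (Q b\<^sub>1) C c\<^sub>1" "best (R c\<^sub>1) A a\<^sub>0"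
      using p[OF A(1)] p[OF A(2)] q[OF B(1)] q[OF B(2)] r[OF C(1)] r[OF C(2)] rc
      by (simp_all add: defs)
    show ?thesis
    proof (rule ccontr)
      assume "\<not> solvable P Q R A B C"
      with dist lin best have "two_cycle P Q R a\<^sub>0 a\<^sub>1 a\<^sub>2 a\<^sub>3 b\<^sub>0 b\<^sub>1 b\<^sub>2 b\<^sub>3 c\<^sub>0 c\<^sub>1 c\<^sub>2 c\<^sub>3"
        unfolding eqs by (intro two_cycle.intro)
      then show False
        by (rule two_cycle.contradiction)
    qed
  qed
qed

section \<open>Back to markets and blocks of agents\<close>

lemma solvable_stable_matching:
  assumes "solvable (wpref G) (mpref G) (dpref G) (women G) (men G) (dogs G)"
  shows "\<exists>M. stable_matching G M"
proof -
  obtain M where M: "perfect (women G) (men G) (dogs G) M"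
    and unblocked: "unblocked (wpref G) (mpref G) (dpref G) M"
    using assms unfolding solvable_def by blast
  have "M \<subseteq> triples G"
    using perfect_mem[OF M] by (auto simp: triples_def)
  moreover have "partition_on (agents G) (members ` M)"
  proof (rule partition_onI)
    show "\<Union> (members ` M) = agents G"
    proof
      show "\<Union> (members ` M) \<subseteq> agents G"
        using perfect_mem[OF M] by (auto simp: agents_def)
      show "agents G \<subseteq> \<Union> (members ` M)"
      proof
        fix x
        assume "x \<in> agents G"
        then obtain a b c where "(a, b, c) \<in> M" "x \<in> members (a, b, c)"
          using perfect_obtain[OF M] unfolding agents_def by fastforce
        then show "x \<in> \<Union> (members ` M)"
          by blast
      qed
    qed
    show "disjnt S T" if mem: "S \<in> members ` M" "T \<in> members ` M" and ne: "S \<noteq> T" for S T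
    proof -
      obtain a b c a' b' c' where m: "(a, b, c) \<in> M" "(a', b', c') \<in> M"
        and ST: "S = members (a, b, c)" "T = members (a', b', c')"
        using mem by (metis imageE prod_cases3)
      with ne have "(a, b, c) \<noteq> (a', b', c')"
        by blast
      \<comment> \<open>Triples of \<open>M\<close> that share one coordinate coincide.\<close>
      then have "a \<noteq> a'" "b \<noteq> b'" "c \<noteq> c'"
        using perfect_unique[OF M m] by blast+
      then show ?thesis
        by (simp add: ST disjnt_def)
    qed
    show "{} \<notin> members ` M"
      by auto
  qed
  moreover have "\<not> blocking G M T" for T
  proof
    assume T: "blocking G M T"
    obtain a b c where abc: "T = (a, b, c)"
      by (cases T)
    have "\<exists>S\<in>M. x \<in> members S \<and> prefers G x T S" if "x \<in> members T" for x
      using T that unfolding blocking_def by blast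
    \<comment> \<open>The current triples of the three members are the ones that
      \<open>unblocked\<close> quantifies over.\<close>
    from this[of "Woman a"] this[of "Man b"] this[of "Dog c"]
    obtain b\<^sub>1 c\<^sub>1 a\<^sub>2 c\<^sub>2 a\<^sub>3 b\<^sub>3 where "(a, b\<^sub>1, c\<^sub>1) \<in> M" "(a\<^sub>2, b, c\<^sub>2) \<in> M" "(a\<^sub>3, b\<^sub>3, c) \<in> M"
      "(b, b\<^sub>1) \<in> wpref G a" "(c, c\<^sub>2) \<in> mpref G b" "(a, a\<^sub>3) \<in> dpref G c"
      by (auto simp: abc)
    then show False
      by (rule unblockedD[OF unblocked])
  qed
  ultimately show ?thesis
    unfolding stable_matching_def matching_def by blast
qed

theorem theorem8:
  fixes G :: "('w, 'm, 'd) market"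
  assumes "circular_market 4 G"
  shows "\<exists>M. stable_matching G M"
  using assms
  by (intro solvable_stable_matching linear_prefs_solvable)
    (auto simp: circular_market_def strict_pref_on_def linear_prefs_def)

end
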